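(* Let $d\in\mathbb{N}$, $n\geq d+1$ and $k\in\{0,1,\ldots,d\}$. Let $\mathscr{V}_{n,d}$ be the typical cell of the spherical Voronoi tessellation generated by $n$ independent uniformly distributed random points $X_1,\ldots,X_n$ on the unit sphere $\mathbb{S}^d\subset\mathbb{R}^{d+1}$, and let $P_{n,d+1}^{-1}:=\mathrm{conv}(X_1,\ldots,X_n)\subset\mathbb{R}^{d+1}$ be the convex hull of these points. Then $$\mathbb{E} f_k(\mathscr{V}_{n,d})=\frac{d-k+1}{n}\,\mathbb{E} f_{d-k}(P_{n,d+1}^{-1}).$$
   Context: Let $\mathbb{S}^d$ be the unit sphere in $\mathbb{R}^{d+1}$ centred at the origin, $\sigma_d$ the normalized (probability) spherical Lebesgue measure on it, $\rho$ the geodesic distance on $\mathbb{S}^d$, and $e=(1,0,\ldots,0)\in\mathbb{S}^d$ the north pole. The points $X_1,\ldots,X_n$ are independent with distribution $\sigma_d$. Spherical Voronoi tessellation: the Voronoi cells are $C_{i,n}:=\{z\in\mathbb{S}^d:\rho(X_i,z)\leq\rho(X_j,z)\text{ for all }j\in\{1,\ldots,n\}\}$, $i\in\{1,\ldots,n\}$. Typical cell: for every $v\in\mathbb{S}^d$ fix an orthogonal transformation $O_v:\mathbb{R}^{d+1}\to\mathbb{R}^{d+1}$ with $O_v v=e$ whose matrix entries are Borel functions of $v$. Let $N$ be uniformly distributed on $\{1,\ldots,n\}$, independent of $X_1,\ldots,X_n$. The typical cell is the random spherical polytope $\mathscr{V}_{n,d}:=O_{X_N}C_{N,n}$. Faces: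 a spherical polytope $P$ is the intersection of $\mathbb{S}^d$ with a polyhedral convex cone $C\subset\mathbb{R}^{d+1}$ (a finite intersection of closed half-spaces whose bounding hyperplanes contain the origin). The $k$-dimensional faces of $P$ are the intersections of the $(k+1)$-dimensional faces of $C$ with $\mathbb{S}^d$, $k\in\{0,\ldots,d\}$; $f_k(P)$ is their number. (This definition through the cone is also used when $P$ contains antipodal points.) For a convex polytope $P$ in Euclidean space, $f_k(P)$ denotes the number of its $k$-dimensional faces (a polytope of dimension $k$ counts as a $k$-dimensional face of itself). *)

theory Defs
  imports "HOL-Probability.Probability"
begin

text \<open>
  The normalized spherical Lebesgue measure, as the cone measure: the measure of a Borel set \<open>A\<close>
  of the sphere is the volume of \<open>{r x | 0 < r < 1, x \<in> A}\<close> divided by the volume of the unit ball.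
  Note that \<open>sgn x = x / norm x\<close>; the restriction only removes the null set \<open>{0}\<close>, so that the
  measure space has the sphere itself as its carrier.
\<close>

definition sphere_measure :: "'a::euclidean_space measure" where
  "sphere_measure =
     restrict_space (distr (uniform_measure lborel (ball 0 1)) borel sgn) (sphere 0 1)"

definition geodesic_dist :: "'a::real_inner \<Rightarrow> 'a \<Rightarrow> real" where
  "geodesic_dist x y = arccos (x \<bullet> y)"

definition voronoi_cell :: "(nat \<Rightarrow> 'a::real_inner) \<Rightarrow> nat \<Rightarrow> nat \<Rightarrow> 'a set" where
  "voronoi_cell x n i =
     {z \<in> sphere 0 1. \<forall>j\<in>{1..n}. geodesic_dist (x i) z \<le> geodesic_dist (x j) z}"

text \<open>The typical cell for the point configuration \<open>x\<close>, if the randomly chosen index is \<open>i\<close>.\<close>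

definition typical_cell ::
    "('a::real_inner \<Rightarrow> 'a \<Rightarrow> 'a) \<Rightarrow> (nat \<Rightarrow> 'a) \<Rightarrow> nat \<Rightarrow> nat \<Rightarrow> 'a set" where
  "typical_cell rot x n i = rot (x i) ` voronoi_cell x n i"

definition polyhedral_cone :: "'a::euclidean_space set \<Rightarrow> bool" where
  "polyhedral_cone C \<longleftrightarrow>
     (\<exists>A. finite A \<and> 0 \<notin> A \<and> C = (\<Inter>a\<in>A. {z. a \<bullet> z \<le> 0}))"

text \<open>
  The cone \<open>C\<close> is determined by \<open>P\<close>.  A nonempty face of a polyhedral cone contains the
  origin, so its affine dimension is its linear dimension.
\<close>

definition spherical_faces :: "nat \<Rightarrow> 'a::euclidean_space set \<Rightarrow> 'a set set" where
  "spherical_faces k P =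
     {F \<inter> sphere 0 1 | F C. polyhedral_cone C \<and> P = C \<inter> sphere 0 1 \<and>
        F face_of C \<and> aff_dim F = int k + 1}"

definition spherical_f :: "nat \<Rightarrow> 'a::euclidean_space set \<Rightarrow> nat" where
  "spherical_f k P = card (spherical_faces k P)"

definition polytope_f :: "nat \<Rightarrow> 'a::euclidean_space set \<Rightarrow> nat" where
  "polytope_f k P = card {F. F face_of P \<and> aff_dim F = int k}"

end

theory Submission
  imports Defs
begin

text \<open>
  Since \<open>arccos\<close> is decreasing, the Voronoi cell of \<open>x i\<close> is the intersection of the sphere with the
  normal cone of the polytope \<open>P = conv {x 1, \<dots>, x n}\<close> at \<open>x i\<close>.  Encode a face of \<open>P\<close> by the set \<open>J\<close> of
  indices at which a linear functional is maximal.  Sending \<open>J\<close> to the convex hull of \<open>x ` J\<close>, and to its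
  normal cone, identifies the \<open>m\<close>-dimensional faces of \<open>P\<close> through \<open>x i\<close> with the
  \<open>(d + 1 - m)\<close>-dimensional faces of the cone at \<open>x i\<close>.  This holds for every configuration of
  points, so that the face numbers are finite sums of indicators of measurable events.  Almost surely
  the points are in general position, whence a \<open>(d - k)\<close>-dimensional face has exactly \<open>d - k + 1\<close>
  vertices; double counting the pairs of such a face and one of its vertices, and averaging over the
  independent uniform index, gives the factor \<open>(d - k + 1) / n\<close>.
\<close>

section \<open>Faces of a polytope and of its normal cones\<close>

text \<open>Faces are recorded by indices rather than by points, so that every configuration draws
  its candidates from the same finite family of subsets of \<open>I\<close>, and coinciding points
  need no separate treatment.\<close>

definition maximizers :: "('i \<Rightarrow> 'a::real_inner) \<Rightarrow> 'i set \<Rightarrow> 'a \<Rightarrow> 'i set" where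
  "maximizers x I z = {i\<in>I. \<forall>j\<in>I. x j \<bullet> z \<le> x i \<bullet> z}"

text \<open>The normal cone of the polytope along the points indexed by \<open>J\<close>, cut out by
  half-spaces through the origin. The value is empty unless \<open>J\<close> is contained in
  \<open>I\<close>.\<close>

definition normal_cone :: "('i \<Rightarrow> 'a::real_inner) \<Rightarrow> 'i set \<Rightarrow> 'i set \<Rightarrow> 'a set" where
  "normal_cone x I J = {z. J \<subseteq> maximizers x I z}"

lemma maximizers_nonempty:
  assumes "finite I" "I \<noteq> {}"
  shows "maximizers x I z \<noteq> {}"
proof -
  have "Max ((\<lambda>i. x i \<bullet> z) ` I) \<in> (\<lambda>i. x i \<bullet> z) ` I"
    using assms by (intro Max_in) auto
  then obtain i where "i \<in> I" "x i \<bullet> z = Max ((\<lambda>i. x i \<bullet> z) ` I)"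
    by auto
  with assms show ?thesis
    by (auto simp: maximizers_def)
qed

lemma maximizers_scaleR:
  assumes "c > 0"
  shows "maximizers x I (c *\<^sub>R z) = maximizers x I z"
  using assms by (simp add: maximizers_def)

lemma convex_hull_subset_halfspace_le:
  assumes "\<And>i. i \<in> I \<Longrightarrow> z \<bullet> x i \<le> c"
  shows "convex hull (x ` I) \<subseteq> {y. z \<bullet> y \<le> c}"
  using assms by (intro hull_minimal convex_halfspace_le) blast

text \<open>A face of the convex hull of a finite set is the hull of some of its generators. Those
  generators lie on the hyperplane, so the bound \<open>c\<close> is attained at an index and the
  generators on the hyperplane are exactly the maximizers.\<close>

lemma supporting_hyperplane_Int_convex_hull:
  fixes x :: "'i \<Rightarrow> 'a::euclidean_space"
  assumes I: "finite I" and le: "\<And>i. i \<in> I \<Longrightarrow> z \<bullet> x i \<le> c"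
    and ne: "convex hull (x ` I) \<inter> {y. z \<bullet> y = c} \<noteq> {}"
  shows "convex hull (x ` I) \<inter> {y. z \<bullet> y = c} = convex hull (x ` maximizers x I z)"
    and "maximizers x I z = {i\<in>I. z \<bullet> x i = c}"
proof -
  let ?F = "convex hull (x ` I) \<inter> {y. z \<bullet> y = c}"
  have "convex hull (x ` I) \<subseteq> {y. z \<bullet> y \<le> c}"
    using le by (rule convex_hull_subset_halfspace_le)
  hence face: "?F face_of convex hull (x ` I)"
    by (intro face_of_Int_supporting_hyperplane_le) auto
  have "compact (x ` I)"
    using I by (simp add: finite_imp_compact)
  then obtain S where S: "S \<subseteq> x ` I" "?F = convex hull S"
    using face by (rule face_of_convex_hull_subset)
  have S2: "S \<subseteq> {y. z \<bullet> y = c}"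
    using S(2) hull_subset[of S convex] by blast
  from ne S(2) have "S \<noteq> {}"
    by auto
  then obtain i0 where i0: "i0 \<in> I" "z \<bullet> x i0 = c"
    using S(1) S2 by auto
  show m: "maximizers x I z = {i\<in>I. z \<bullet> x i = c}"
  proof (intro equalityI subsetI)
    fix i assume "i \<in> maximizers x I z"
    hence "i \<in> I" "c \<le> z \<bullet> x i"
      using i0 by (auto simp: maximizers_def inner_commute[of z])
    with le[of i] show "i \<in> {i\<in>I. z \<bullet> x i = c}"
      by simp
  next
    fix i assume "i \<in> {i\<in>I. z \<bullet> x i = c}"
    with le show "i \<in> maximizers x I z"
      by (simp add: maximizers_def inner_commute[of z])
  qed
  have "S \<subseteq> x ` maximizers x I z"
    using S(1) S2 unfolding m by auto
  hence "?F \<subseteq> convex hull (x ` maximizers x I z)"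
    unfolding S(2) by (rule hull_mono)
  moreover have "convex hull (x ` maximizers x I z) \<subseteq> ?F"
    unfolding m by (intro hull_minimal convex_Int convex_convex_hull convex_hyperplane)
      (use hull_subset[of "x ` I" convex] in blast)
  ultimately show "?F = convex hull (x ` maximizers x I z)"
    by (rule antisym)
qed

lemma maximizers_supporting_hyperplane:
  fixes x :: "'i \<Rightarrow> 'a::euclidean_space"
  assumes "finite I" "I \<noteq> {}"
  obtains c where "\<And>i. i \<in> I \<Longrightarrow> z \<bullet> x i \<le> c" "maximizers x I z = {i\<in>I. z \<bullet> x i = c}"
    "convex hull (x ` I) \<inter> {y. z \<bullet> y = c} = convex hull (x ` maximizers x I z)"
proof -
  obtain i where i: "i \<in> I" "\<And>j. j \<in> I \<Longrightarrow> z \<bullet> x j \<le> z \<bullet> x i"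
    using maximizers_nonempty[OF assms, of x z] by (auto simp: maximizers_def inner_commute)
  have "convex hull (x ` I) \<inter> {y. z \<bullet> y = z \<bullet> x i} \<noteq> {}"
    using i(1) hull_inc[of "x i" "x ` I" convex] by blast
  note * = supporting_hyperplane_Int_convex_hull[OF assms(1) i(2) this]
  show ?thesis
    by (rule that[OF i(2) *(2,1)])
qed

text \<open>Injectivity: a set of maximizers consists of all indices whose points lie in the
  corresponding face. Surjectivity: every face of a polytope is exposed, and the exposing functional
  has the required maximizers.\<close>

lemma bij_betw_faces_convex_hull:
  fixes x :: "'i \<Rightarrow> 'a::euclidean_space"
  assumes I: "finite I" "I \<noteq> {}"
  shows "bij_betw (\<lambda>J. convex hull (x ` J)) {J \<in> range (maximizers x I). aff_dim (x ` J) = int m}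
           {F. F face_of convex hull (x ` I) \<and> aff_dim F = int m}"
  unfolding bij_betw_def
proof
  have *: "J = {i\<in>I. x i \<in> convex hull (x ` J)}" if "J \<in> range (maximizers x I)" for J
  proof -
    from that obtain z where z: "J = maximizers x I z"
      by auto
    obtain c where c: "J = {i\<in>I. z \<bullet> x i = c}"
        "convex hull (x ` I) \<inter> {y. z \<bullet> y = c} = convex hull (x ` J)"
      using maximizers_supporting_hyperplane[OF I] unfolding z by metis
    have "x i \<in> convex hull (x ` J) \<longleftrightarrow> z \<bullet> x i = c" if "i \<in> I" for i
      using that unfolding c(2)[symmetric] by (simp add: hull_inc)
    thus ?thesis
      using c(1) by auto
  qed
  show "inj_on (\<lambda>J. convex hull (x ` J)) {J \<in> range (maximizers x I). aff_dim (x ` J) = int m}"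
    by (rule inj_on_inverseI[where g = "\<lambda>F. {i\<in>I. x i \<in> F}"]) (rule *[symmetric], simp)
  show "(\<lambda>J. convex hull (x ` J)) ` {J \<in> range (maximizers x I). aff_dim (x ` J) = int m} =
      {F. F face_of convex hull (x ` I) \<and> aff_dim F = int m}" (is "?L = ?R")
  proof (intro equalityI subsetI)
    fix F assume "F \<in> ?L"
    then obtain z where z: "F = convex hull (x ` maximizers x I z)"
        "aff_dim (x ` maximizers x I z) = int m"
      by auto
    obtain c where c: "\<And>i. i \<in> I \<Longrightarrow> z \<bullet> x i \<le> c"
        "convex hull (x ` I) \<inter> {y. z \<bullet> y = c} = F"
      using maximizers_supporting_hyperplane[OF I] unfolding z by metis
    have "convex hull (x ` I) \<subseteq> {y. z \<bullet> y \<le> c}"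
      using c(1) by (rule convex_hull_subset_halfspace_le)
    hence "F face_of convex hull (x ` I)"
      unfolding c(2)[symmetric] by (intro face_of_Int_supporting_hyperplane_le) auto
    thus "F \<in> ?R"
      using z by (simp add: aff_dim_convex_hull)
  next
    fix F assume F: "F \<in> ?R"
    have "polyhedron (convex hull (x ` I))"
      using I by (intro polytope_imp_polyhedron) (auto simp: polytope_def)
    with F have "F exposed_face_of convex hull (x ` I)"
      by (simp add: exposed_face_of_polyhedron)
    then obtain a b where ab: "convex hull (x ` I) \<subseteq> {y. a \<bullet> y \<le> b}"
        "F = convex hull (x ` I) \<inter> {y. a \<bullet> y = b}"
      by (auto simp: exposed_face_of_def)
    have "a \<bullet> x i \<le> b" if "i \<in> I" for i
      using ab(1) hull_subset[of "x ` I" convex] that by blast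
    \<comment> \<open>The empty face has dimension -1, which is not of the form
      \<open>int m\<close>.\<close>
    moreover have "F \<noteq> {}"
      using F by auto
    ultimately have "F = convex hull (x ` maximizers x I a)"
      using supporting_hyperplane_Int_convex_hull(1)[OF I(1), of a x b] unfolding ab(2) by simp
    thus "F \<in> ?L"
      using F by (auto simp: aff_dim_convex_hull)
  qed
qed

lemma maximizers_normal_cone: "z \<in> normal_cone x I (maximizers x I z)"
  by (simp add: normal_cone_def)

lemma normal_cone_scaleR: "z \<in> normal_cone x I J \<Longrightarrow> c > 0 \<Longrightarrow> c *\<^sub>R z \<in> normal_cone x I J"
  by (simp add: normal_cone_def maximizers_scaleR)

lemma convex_normal_cone: "convex (normal_cone x I J)"
proof (cases "J \<subseteq> I")
  case True
  hence "normal_cone x I J = (\<Inter>i\<in>J. \<Inter>j\<in>I. {z. (x j - x i) \<bullet> z \<le> 0})"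
    by (auto simp: normal_cone_def maximizers_def inner_diff_left)
  thus ?thesis
    by (simp only:) (intro convex_INT convex_halfspace_le)
next
  case False
  hence "normal_cone x I J = {}"
    by (auto simp: normal_cone_def maximizers_def)
  thus ?thesis by simp
qed

text \<open>The sum of the vectors \<open>x j - x i\<close> over \<open>J\<close> defines a
  supporting hyperplane: each summand is nonpositive on the cone at \<open>i\<close>, so the sum
  vanishes at \<open>z\<close> only if every \<open>j\<close> in \<open>J\<close> ties with
  \<open>i\<close>.\<close>

lemma normal_cone_face:
  assumes "i \<in> J" "J \<subseteq> I" "finite J"
  shows "normal_cone x I J face_of normal_cone x I {i}"
proof -
  have "normal_cone x I J = normal_cone x I {i} \<inter> {z. (\<Sum>j\<in>J. x j - x i) \<bullet> z = 0}"
  proof (intro equalityI subsetI)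
    fix z assume "z \<in> normal_cone x I J"
    with assms show "z \<in> normal_cone x I {i} \<inter> {z. (\<Sum>j\<in>J. x j - x i) \<bullet> z = 0}"
      by (auto simp: normal_cone_def maximizers_def inner_sum_left inner_diff_left subset_iff
          intro!: sum.neutral antisym)
  next
    fix z assume z: "z \<in> normal_cone x I {i} \<inter> {z. (\<Sum>j\<in>J. x j - x i) \<bullet> z = 0}"
    hence le: "x j \<bullet> z \<le> x i \<bullet> z" if "j \<in> I" for j
      using that by (auto simp: normal_cone_def maximizers_def)
    have "(\<Sum>j\<in>J. x i \<bullet> z - x j \<bullet> z) = 0"
      using z by (simp add: inner_sum_left inner_diff_left sum_subtractf)
    hence "x j \<bullet> z = x i \<bullet> z" if "j \<in> J" for j
      using that assms le by (subst (asm) sum_nonneg_eq_0_iff) (auto simp: subset_iff)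
    hence "J \<subseteq> maximizers x I z"
      using assms(2) le by (fastforce simp: maximizers_def)
    thus "z \<in> normal_cone x I J"
      by (simp add: normal_cone_def)
  qed
  moreover have "(\<Sum>j\<in>J. x j - x i) \<bullet> z \<le> 0" if "z \<in> normal_cone x I {i}" for z
    using that assms
    by (auto simp: normal_cone_def maximizers_def inner_sum_left inner_diff_left intro!: sum_nonpos)
  ultimately show ?thesis
    using face_of_Int_supporting_hyperplane_le[OF convex_normal_cone[of x I "{i}"],
      of "\<Sum>j\<in>J. x j - x i" 0]
    by simp
qed

text \<open>Ties among the indices in \<open>J\<close> are linear equations, and the inequalities
  for the remaining indices are strict at \<open>z\<close>. Hence near \<open>z\<close> the cone
  coincides with the solution space \<open>L\<close> of the equations, which gives both the relative
  interior point and the dimension.\<close>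

lemma normal_cone_maximizers:
  fixes x :: "'i \<Rightarrow> 'a::euclidean_space" and z :: 'a
  assumes I: "finite I" "I \<noteq> {}"
  defines "J \<equiv> maximizers x I z"
  shows "z \<in> rel_interior (normal_cone x I J)"
    and "aff_dim (normal_cone x I J) = int DIM('a) - aff_dim (x ` J)"
proof -
  obtain i where i: "i \<in> J"
    using maximizers_nonempty[OF I, of x z] unfolding J_def by blast
  have iI: "i \<in> I" and JI: "J \<subseteq> I"
    using i by (auto simp: J_def maximizers_def)
  \<comment> \<open>\<open>L\<close> is the orthogonal complement of the direction space of the
    affine hull of the points indexed by \<open>J\<close>.\<close>
  define L where "L = {w. \<forall>v\<in>span ((\<lambda>y. y - x i) ` x ` J). orthogonal v w}"
  have L_iff: "w \<in> L \<longleftrightarrow> (\<forall>j\<in>J. x j \<bullet> w = x i \<bullet> w)" for w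
  proof -
    have "w \<in> L \<longleftrightarrow> (\<forall>v\<in>(\<lambda>y. y - x i) ` x ` J. orthogonal w v)"
    proof
      assume "w \<in> L"
      thus "\<forall>v\<in>(\<lambda>y. y - x i) ` x ` J. orthogonal w v"
        unfolding L_def by (simp add: orthogonal_commute span_base)
    next
      assume "\<forall>v\<in>(\<lambda>y. y - x i) ` x ` J. orthogonal w v"
      hence "orthogonal w v" if "v \<in> span ((\<lambda>y. y - x i) ` x ` J)" for v
        using that orthogonal_to_span by blast
      thus "w \<in> L"
        unfolding L_def by (simp add: orthogonal_commute)
    qed
    also have "\<dots> \<longleftrightarrow> (\<forall>j\<in>J. x j \<bullet> w = x i \<bullet> w)"
      by (simp add: orthogonal_def inner_diff_right inner_commute)
    finally show ?thesis .
  qed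
  have subL: "subspace L"
    unfolding L_def by (auto simp: subspace_def orthogonal_clauses)
  define U where "U = (\<Inter>j\<in>I - J. {w. (x j - x i) \<bullet> w < 0})"
  have U: "open U"
    using I unfolding U_def by (auto intro!: open_INT open_halfspace_lt)
  have zU: "z \<in> U" and zL: "z \<in> L"
    using i unfolding L_iff U_def J_def maximizers_def
    by (force simp: inner_diff_left intro: antisym not_le_imp_less)+
  have NL: "normal_cone x I J \<subseteq> L"
    using i JI unfolding L_iff[abs_def] subset_iff normal_cone_def maximizers_def
    by (auto intro: antisym)
  have LU: "L \<inter> U \<subseteq> normal_cone x I J"
  proof
    fix w assume "w \<in> L \<inter> U"
    hence w: "w \<in> L" "w \<in> U"
      by auto
    have eq: "x j \<bullet> w = x i \<bullet> w" if "j \<in> J" for j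
      using w(1) that by (simp add: L_iff)
    have lt: "x j \<bullet> w < x i \<bullet> w" if "j \<in> I - J" for j
      using w(2) that by (simp add: U_def inner_diff_left)
    have "x j \<bullet> w \<le> x i \<bullet> w" if "j \<in> I" for j
      using eq lt that by (cases "j \<in> J") (auto intro: less_imp_le)
    thus "w \<in> normal_cone x I J"
      using eq JI by (auto simp: normal_cone_def maximizers_def)
  qed
  have "affine hull (normal_cone x I J) \<subseteq> L"
    using NL subL by (simp add: hull_minimal subspace_imp_affine)
  thus "z \<in> rel_interior (normal_cone x I J)"
    unfolding mem_rel_interior using U zU LU maximizers_normal_cone[of z x I]
    by (auto simp: J_def)
  \<comment> \<open>The cone lies between \<open>L \<inter> U\<close> and \<open>L\<close>, and an
    open set meeting \<open>L\<close> does not lower its dimension.\<close>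
  have "aff_dim (L \<inter> U) = aff_dim L"
    using zU zL U subL by (intro aff_dim_convex_Int_open) (auto simp: subspace_imp_convex)
  hence "aff_dim (normal_cone x I J) = aff_dim L"
    using aff_dim_subset[OF NL] aff_dim_subset[OF LU] by simp
  also have "\<dots> = int (dim L)"
    using subL by (rule aff_dim_subspace)
  also have "dim L + dim ((\<lambda>y. y - x i) ` x ` J) = DIM('a)"
    using dim_subspace_orthogonal_to_vectors[of "span ((\<lambda>y. y - x i) ` x ` J)" UNIV]
    by (simp add: L_def subspace_span)
  hence "int (dim L) = int DIM('a) - int (dim ((\<lambda>y. y - x i) ` x ` J))"
    by linarith
  also have "int (dim ((\<lambda>y. y - x i) ` x ` J)) = aff_dim (x ` J)"
    using i by (intro aff_dim_eq_dim_subtract[symmetric]) (auto intro: hull_inc)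
  finally show "aff_dim (normal_cone x I J) = int DIM('a) - aff_dim (x ` J)" .
qed

text \<open>A nonempty face \<open>G\<close> is identified by the maximizers of any \<open>z\<close>
  in its relative interior. That \<open>z\<close> is also relatively interior to the normal cone of
  these maximizers, and two faces with a common relative interior point coincide.\<close>

lemma faces_normal_cone:
  fixes x :: "'i \<Rightarrow> 'a::euclidean_space"
  assumes I: "finite I" and i: "i \<in> I"
  shows "{G. G face_of normal_cone x I {i} \<and> G \<noteq> {}} =
           normal_cone x I ` {J \<in> range (maximizers x I). i \<in> J}" (is "?L = ?R")
proof (intro equalityI subsetI)
  from i have ne: "I \<noteq> {}"
    by blast
  fix G assume G: "G \<in> ?L"
  hence "convex G"
    using face_of_imp_convex by auto
  with G obtain z where z: "z \<in> rel_interior G"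
    using rel_interior_eq_empty by auto
  hence zG: "z \<in> G"
    using rel_interior_subset by blast
  have sub: "G \<subseteq> normal_cone x I {i}"
    using G face_of_imp_subset by blast
  let ?J = "maximizers x I z"
  have iJ: "i \<in> ?J"
    using zG sub by (auto simp: normal_cone_def)
  have JI: "?J \<subseteq> I"
    by (auto simp: maximizers_def)
  have face: "normal_cone x I ?J face_of normal_cone x I {i}"
    using iJ JI I by (auto intro!: normal_cone_face intro: finite_subset)
  have "G \<subseteq> normal_cone x I ?J"
    using face sub z maximizers_normal_cone by (intro subset_of_face_of[OF face sub]) blast
  moreover have "normal_cone x I ?J \<subseteq> G"
    using G zG face_of_imp_subset[OF face] normal_cone_maximizers(1)[OF I ne, of z x]
    by (intro subset_of_face_of[of G "normal_cone x I {i}"]) auto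
  ultimately show "G \<in> ?R"
    using iJ by blast
next
  fix G assume "G \<in> ?R"
  then obtain z where z: "G = normal_cone x I (maximizers x I z)" "i \<in> maximizers x I z"
    by auto
  have "maximizers x I z \<subseteq> I"
    by (auto simp: maximizers_def)
  with z I show "G \<in> ?L"
    using maximizers_normal_cone[of z x I] by (auto intro!: normal_cone_face intro: finite_subset)
qed

text \<open>A unit vector whose maximizers are exactly \<open>J\<close> lies in the cone of
  \<open>J'\<close>, which forces the inclusion. The dimension bound excludes the cone
  \<open>{0}\<close>, which leaves no trace on the sphere. Applied in both directions, the inclusion
  gives injectivity.\<close>

lemma maximizers_eq_if_normal_cone_Int_sphere_eq:
  fixes x :: "'i \<Rightarrow> 'a::euclidean_space"
  assumes J: "J \<in> range (maximizers x I)" and dim: "aff_dim (normal_cone x I J) \<ge> 1"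
    and eq: "normal_cone x I J \<inter> sphere 0 1 = normal_cone x I J' \<inter> sphere 0 1"
  shows "J' \<subseteq> J"
proof -
  obtain z where z: "J = maximizers x I z"
    using J by auto
  have "\<not> normal_cone x I J \<subseteq> {0}"
    using dim aff_dim_subset[of "normal_cone x I J" "{0}"] by auto
  then obtain w where w: "w \<in> normal_cone x I J" "w \<noteq> 0"
    by auto
  obtain u where u: "J = maximizers x I u" "u \<noteq> 0"
  \<comment> \<open>The zero functional is maximal at every index, so \<open>J = I\<close>; a
    nonzero \<open>w\<close> in the cone then also has all of \<open>I\<close> as maximizers and
    replaces \<open>z\<close>.\<close>
  proof (cases "z = 0")
    case True
    hence "J = I"
      by (auto simp: z maximizers_def)
    with w have "J = maximizers x I w"
      by (auto simp: normal_cone_def maximizers_def)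
    thus ?thesis
      using w that by blast
  qed (use z that in blast)
  have "(1 / norm u) *\<^sub>R u \<in> normal_cone x I J \<inter> sphere 0 1"
    using u maximizers_normal_cone[of u x I] by (auto intro!: normal_cone_scaleR)
  hence "(1 / norm u) *\<^sub>R u \<in> normal_cone x I J'"
    unfolding eq by blast
  hence "J' \<subseteq> maximizers x I ((1 / norm u) *\<^sub>R u)"
    by (simp add: normal_cone_def)
  thus ?thesis
    using u by (simp add: maximizers_scaleR)
qed

section \<open>Spherical polytopes and Voronoi cells\<close>

lemma polyhedral_cone_scaleR: "polyhedral_cone C \<Longrightarrow> z \<in> C \<Longrightarrow> c \<ge> 0 \<Longrightarrow> c *\<^sub>R z \<in> C"
  unfolding polyhedral_cone_def by (auto simp: mult_nonneg_nonpos)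

text \<open>Every polyhedral cone contains the origin, and each of its other points is a positive
  multiple of a unit vector in it.\<close>

lemma polyhedral_cone_eqI:
  assumes C: "polyhedral_cone C" "polyhedral_cone D" and eq: "C \<inter> sphere 0 1 = D \<inter> sphere 0 1"
  shows "C = D"
proof -
  have "C \<subseteq> D" if C: "polyhedral_cone C" "polyhedral_cone D" and sub: "C \<inter> sphere 0 1 \<subseteq> D"
    for C D :: "'a set"
  proof
    fix z assume z: "z \<in> C"
    show "z \<in> D"
    proof (cases "z = 0")
      case True
      thus ?thesis
        using C(2) by (auto simp: polyhedral_cone_def)
    next
      case False
      have "(1 / norm z) *\<^sub>R z \<in> C \<inter> sphere 0 1"
        using polyhedral_cone_scaleR[OF C(1) z, of "1 / norm z"] False by auto
      with sub have "(1 / norm z) *\<^sub>R z \<in> D"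
        by blast
      hence "norm z *\<^sub>R ((1 / norm z) *\<^sub>R z) \<in> D"
        by (rule polyhedral_cone_scaleR[OF C(2)]) simp
      thus ?thesis
        using False by simp
    qed
  qed
  from this[of C D] this[of D C] C eq show ?thesis
    by blast
qed

lemma polyhedral_cone_orthogonal_image:
  fixes f :: "'a::euclidean_space \<Rightarrow> 'a"
  assumes f: "orthogonal_transformation f" and C: "polyhedral_cone C"
  shows "polyhedral_cone (f ` C)"
proof -
  obtain A where A: "finite A" "0 \<notin> A" "C = (\<Inter>a\<in>A. {z. a \<bullet> z \<le> 0})"
    using C by (auto simp: polyhedral_cone_def)
  have lin: "linear f" and inj: "inj f" and surj: "surj f" and inner: "\<And>v w. f v \<bullet> f w = v \<bullet> w"
    using f orthogonal_transformation_inj orthogonal_transformation_surj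
    by (auto simp: orthogonal_transformation_def)
  have "f ` C = (\<Inter>a\<in>f ` A. {z. a \<bullet> z \<le> 0})"
  proof (intro equalityI subsetI)
    fix y assume y: "y \<in> (\<Inter>a\<in>f ` A. {z. a \<bullet> z \<le> 0})"
    obtain z where "y = f z"
      using surj by blast
    with y show "y \<in> f ` C"
      by (auto simp: A inner)
  qed (auto simp: A inner)
  moreover have "0 \<notin> f ` A"
    using A(2) inj lin by (auto simp: linear_injective_0)
  ultimately show ?thesis
    using A(1) unfolding polyhedral_cone_def by blast
qed

lemma polyhedral_cone_normal_cone:
  fixes x :: "'i \<Rightarrow> 'a::euclidean_space"
  assumes "finite I" "i \<in> I"
  shows "polyhedral_cone (normal_cone x I {i})"
proof -
  let ?A = "(\<lambda>j. x j - x i) ` I"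
  have "normal_cone x I {i} = {z. \<forall>a\<in>?A. a \<bullet> z \<le> 0}"
    using assms by (simp add: normal_cone_def maximizers_def inner_diff_left)
  \<comment> \<open>The index \<open>i\<close> itself, and any point coinciding with
    \<open>x i\<close>, gives the normal 0, which \<open>polyhedral_cone\<close> does not admit; its
    constraint is void.\<close>
  also have "\<dots> = {z. \<forall>a\<in>?A - {0}. a \<bullet> z \<le> 0}"
    by (rule Collect_cong) (auto simp only: Ball_def Diff_iff singleton_iff inner_zero_left order_refl)
  finally have "normal_cone x I {i} = (\<Inter>a\<in>?A - {0}. {z. a \<bullet> z \<le> 0})"
    by blast
  moreover have "finite (?A - {0})" "0 \<notin> ?A - {0}"
    using assms by auto
  ultimately show ?thesis
    unfolding polyhedral_cone_def by blast
qed

text \<open>The definition ranges over all cones that cut out the given set; by uniqueness only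
  \<open>C\<close> remains.\<close>

lemma spherical_faces_eq:
  fixes C :: "'a::euclidean_space set"
  assumes "polyhedral_cone C"
  shows "spherical_faces k (C \<inter> sphere 0 1) =
    (\<lambda>G. G \<inter> sphere 0 1) ` {G. G face_of C \<and> aff_dim G = int k + 1}"
proof -
  let ?S = "sphere 0 1 :: 'a set"
  have *: "polyhedral_cone D \<and> C \<inter> ?S = D \<inter> ?S \<and> F face_of D \<and> aff_dim F = int k + 1 \<longleftrightarrow>
      D = C \<and> F face_of C \<and> aff_dim F = int k + 1" for D F
    using assms polyhedral_cone_eqI[OF assms, of D] by blast
  show ?thesis
    unfolding spherical_faces_def * by blast
qed

lemma voronoi_cell_eq_normal_cone:
  assumes x: "\<And>j. j \<in> {1..n} \<Longrightarrow> x j \<in> sphere 0 1" and i: "i \<in> {1..n}"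
  shows "voronoi_cell x n i = normal_cone x {1..n} {i} \<inter> sphere 0 1"
proof -
  \<comment> \<open>The order reversal of \<open>arccos\<close> is available on the interval from -1
    to 1 only.\<close>
  have "\<bar>x j \<bullet> z\<bar> \<le> 1" if "j \<in> {1..n}" "norm z = 1" for j z
    using Cauchy_Schwarz_ineq2[of "x j" z] x[OF that(1)] that(2) by simp
  thus ?thesis
    using i by (auto simp: voronoi_cell_def geodesic_dist_def normal_cone_def maximizers_def
        arccos_le_mono)
qed

text \<open>An orthogonal map carries faces to faces, keeps their dimension and commutes with
  intersecting with the sphere. A cone face of dimension \<open>k + 1\<close> corresponds to points
  spanning the complementary dimension \<open>DIM('a) - (k + 1)\<close>.\<close>

lemma bij_betw_faces_typical_cell:
  fixes x :: "nat \<Rightarrow> 'a::euclidean_space"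
  assumes x: "\<And>j. j \<in> {1..n} \<Longrightarrow> x j \<in> sphere 0 1" and i: "i \<in> {1..n}"
    and f: "orthogonal_transformation (rot (x i))"
  shows "bij_betw (\<lambda>J. rot (x i) ` normal_cone x {1..n} J \<inter> sphere 0 1)
     {J \<in> range (maximizers x {1..n}). i \<in> J \<and> aff_dim (x ` J) = int DIM('a) - int k - 1}
     (spherical_faces k (typical_cell rot x n i))"
  unfolding bij_betw_def
proof
  let ?f = "rot (x i)" and ?I = "{1..n}"
  let ?N = "normal_cone x ?I"
  let ?J = "{J \<in> range (maximizers x ?I). i \<in> J \<and> aff_dim (x ` J) = int DIM('a) - int k - 1}"
  have fin: "finite ?I" and ne: "?I \<noteq> {}"
    using i by auto
  have lin: "linear ?f" and inj: "inj ?f" and nrm: "\<And>z. norm (?f z) = norm z"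
    using f orthogonal_transformation_inj orthogonal_transformation_norm
    by (auto simp: orthogonal_transformation_def)
  have sph: "?f ` A \<inter> sphere 0 1 = ?f ` (A \<inter> sphere 0 1)" for A
    by (auto simp: nrm)
  have dim: "aff_dim (?N J) = int k + 1 \<longleftrightarrow> aff_dim (x ` J) = int DIM('a) - int k - 1"
    if "J \<in> range (maximizers x ?I)" for J
    using that normal_cone_maximizers(2)[OF fin ne, of x] by auto
  have "typical_cell rot x n i = ?f ` ?N {i} \<inter> sphere 0 1"
    using voronoi_cell_eq_normal_cone[of n x i] x i by (simp add: typical_cell_def sph)
  hence "spherical_faces k (typical_cell rot x n i) =
      (\<lambda>G. G \<inter> sphere 0 1) ` {G. G face_of (?f ` ?N {i}) \<and> aff_dim G = int k + 1}"
    using spherical_faces_eq polyhedral_cone_orthogonal_image[OF f]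
      polyhedral_cone_normal_cone[OF fin i] by metis
  also have "{G. G face_of (?f ` ?N {i}) \<and> aff_dim G = int k + 1} =
      {G. G face_of (?f ` ?N {i})} \<inter> {G. aff_dim G = int k + 1}"
    by blast
  also have "\<dots> = (`) ?f ` {G. G face_of ?N {i} \<and> aff_dim G = int k + 1}"
    unfolding faces_of_linear_image[OF lin inj] using lin inj by auto
  \<comment> \<open>The empty face has dimension -1, so the dimension condition already excludes
    it.\<close>
  also have "{G. G face_of ?N {i} \<and> aff_dim G = int k + 1} =
      {G. G face_of ?N {i} \<and> G \<noteq> {}} \<inter> {G. aff_dim G = int k + 1}"
    by auto
  also have "\<dots> = ?N ` ?J"
    unfolding faces_normal_cone[OF fin i] using dim by auto
  finally show "(\<lambda>J. ?f ` ?N J \<inter> sphere 0 1) ` ?J = spherical_faces k (typical_cell rot x n i)"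
    by (simp add: image_image)
  show "inj_on (\<lambda>J. ?f ` ?N J \<inter> sphere 0 1) ?J"
  proof (rule inj_onI)
    fix J J' assume J: "J \<in> ?J" "J' \<in> ?J" and "?f ` ?N J \<inter> sphere 0 1 = ?f ` ?N J' \<inter> sphere 0 1"
    hence eq: "?N J \<inter> sphere 0 1 = ?N J' \<inter> sphere 0 1"
      unfolding sph using inj by (simp add: inj_image_eq_iff)
    have "aff_dim (?N J) \<ge> 1" "aff_dim (?N J') \<ge> 1"
      using J dim[of J] dim[of J'] by auto
    thus "J = J'"
      using J eq maximizers_eq_if_normal_cone_Int_sphere_eq[of J x ?I J']
        maximizers_eq_if_normal_cone_Int_sphere_eq[of J' x ?I J] by blast
  qed
qed

section \<open>Measurability and general position\<close>

text \<open>
  A solution can be sought in a ball of integer radius; by compactness of the ball, solvability there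
  means solvability up to every \<open>1 / (m + 1)\<close>, for which a countable dense set of candidates suffices.
\<close>

lemma sets_linear_feasibility:
  fixes v :: "'j \<Rightarrow> 'w \<Rightarrow> 'a::euclidean_space"
  assumes fin: "finite E" "finite S"
    and v[measurable]: "\<And>j. j \<in> E \<union> S \<Longrightarrow> v j \<in> borel_measurable M"
  shows "{w\<in>space M. \<exists>z. (\<forall>j\<in>E. v j w \<bullet> z = 0) \<and> (\<forall>j\<in>S. v j w \<bullet> z \<le> -1)} \<in> sets M"
proof -
  obtain D :: "'a set" where D: "countable D" "\<And>X. open X \<Longrightarrow> X \<noteq> {} \<Longrightarrow> \<exists>d\<in>D. d \<in> X"
    using countable_dense_exists by blast
  let ?e = "\<lambda>m::nat. inverse (real (Suc m))"
  let ?Q = "\<lambda>w K m z. norm z \<le> real K \<and> (\<forall>j\<in>E. \<bar>v j w \<bullet> z\<bar> \<le> ?e m) \<and>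
      (\<forall>j\<in>S. v j w \<bullet> z \<le> -1 + ?e m)"
  have "(\<exists>z. (\<forall>j\<in>E. v j w \<bullet> z = 0) \<and> (\<forall>j\<in>S. v j w \<bullet> z \<le> -1)) \<longleftrightarrow>
      (\<exists>K::nat. \<forall>m. \<exists>z\<in>D. ?Q w K m z)" for w
  proof
    assume "\<exists>z. (\<forall>j\<in>E. v j w \<bullet> z = 0) \<and> (\<forall>j\<in>S. v j w \<bullet> z \<le> -1)"
    then obtain z where z: "\<And>j. j \<in> E \<Longrightarrow> v j w \<bullet> z = 0" "\<And>j. j \<in> S \<Longrightarrow> v j w \<bullet> z \<le> -1"
      by blast
    obtain K :: nat where K: "norm z < real K"
      using reals_Archimedean2 by blast
    have "\<exists>y\<in>D. ?Q w K m y" for m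
    proof -
      let ?X = "ball 0 (real K) \<inter> (\<Inter>j\<in>E. {y. v j w \<bullet> y < ?e m} \<inter> {y. v j w \<bullet> y > - ?e m}) \<inter>
        (\<Inter>j\<in>S. {y. v j w \<bullet> y < -1 + ?e m})"
      have "open ?X"
        using fin by (intro open_Int open_INT open_ball ballI open_halfspace_lt open_halfspace_gt)
      moreover have "v j w \<bullet> z < -1 + ?e m" if "j \<in> S" for j
        using z(2)[OF that] by (smt (verit) inverse_positive_iff_positive of_nat_0_less_iff zero_less_Suc)
      hence "z \<in> ?X"
        using K z(1) by simp
      ultimately obtain y where "y \<in> D" "y \<in> ?X"
        using D(2)[of ?X] by blast
      thus ?thesis
        by (intro bexI[of _ y]) (auto simp: abs_le_iff intro: less_imp_le)
    qed
    thus "\<exists>K::nat. \<forall>m. \<exists>z\<in>D. ?Q w K m z"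
      by blast
  next
    assume "\<exists>K::nat. \<forall>m. \<exists>z\<in>D. ?Q w K m z"
    then obtain K :: nat and y where y: "\<And>m. ?Q w K m (y m)"
      by metis
    have "\<forall>m. y m \<in> cball 0 (real K)"
      using y by auto
    then obtain z r where r: "strict_mono (r :: nat \<Rightarrow> nat)" "(y \<circ> r) \<longlonglongrightarrow> z"
      using compact_imp_seq_compact[OF compact_cball] seq_compactE by metis
    have e: "(\<lambda>m. ?e (r m)) \<longlonglongrightarrow> 0"
      using LIMSEQ_subseq_LIMSEQ[OF LIMSEQ_inverse_real_of_nat r(1)] by (simp add: comp_def)
    have lim: "(\<lambda>m. v j w \<bullet> y (r m)) \<longlonglongrightarrow> v j w \<bullet> z" for j
      using r(2) unfolding comp_def by (intro tendsto_inner tendsto_const)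
    have "\<bar>v j w \<bullet> z\<bar> \<le> 0" if "j \<in> E" for j
      using y that by (intro LIMSEQ_le[OF tendsto_rabs[OF lim] e]) blast
    moreover have "v j w \<bullet> z \<le> -1 + 0" if "j \<in> S" for j
      using y that by (intro LIMSEQ_le[OF lim tendsto_add[OF tendsto_const e]]) blast
    ultimately show "\<exists>z. (\<forall>j\<in>E. v j w \<bullet> z = 0) \<and> (\<forall>j\<in>S. v j w \<bullet> z \<le> -1)"
      by (intro exI[of _ z]) auto
  qed
  moreover have "Measurable.pred M (\<lambda>w. \<exists>K::nat. \<forall>m. \<exists>z\<in>D. ?Q w K m z)"
    using D(1) fin by (intro pred_intros_countable measurable_pred_countable
      pred_intros_logic) (auto simp: countable_finite)
  ultimately show ?thesis
    by (simp add: pred_def)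
qed

text \<open>Being outside an affine hull is certified by a vector orthogonal to its directions but
  not to \<open>y - x i\<close>. Normalizing the latter product to -1 turns this into a linear
  feasibility problem.\<close>

lemma not_in_affine_hull_iff:
  fixes x :: "'j \<Rightarrow> 'a::euclidean_space"
  assumes "i \<in> J"
  shows "y \<notin> affine hull (x ` J) \<longleftrightarrow>
    (\<exists>z. (\<forall>j\<in>J. (x j - x i) \<bullet> z = 0) \<and> (y - x i) \<bullet> z \<le> -1)"
proof
  assume y: "y \<notin> affine hull (x ` J)"
  let ?V = "(\<lambda>p. - x i + p) ` x ` J"
  obtain u v where uv: "u \<in> span ?V" "\<And>w. w \<in> span ?V \<Longrightarrow> orthogonal v w" "y - x i = u + v"
    using orthogonal_subspace_decomp_exists[of ?V "y - x i"] by metis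
  have "x i \<in> affine hull (x ` J)"
    using assms by (simp add: hull_inc)
  hence "affine hull (x ` J) = (\<lambda>p. x i + p) ` span ?V"
    by (rule affine_hull_span_gen)
  moreover have "y = x i + (u + v)"
    using uv(3) by (simp add: algebra_simps)
  ultimately have "v \<noteq> 0"
    using uv(1) y by auto
  \<comment> \<open>Here \<open>v\<close> is the component of \<open>y - x i\<close> orthogonal to
    the affine hull, so \<open>(y - x i) \<bullet> v = v \<bullet> v\<close>.\<close>
  let ?z = "(- 1 / (v \<bullet> v)) *\<^sub>R v"
  have z1: "(x j - x i) \<bullet> ?z = 0" if "j \<in> J" for j
  proof -
    have "- x i + x j \<in> span ?V"
      using that by (intro span_base) auto
    from uv(2)[OF this] show ?thesis
      by (simp add: orthogonal_def inner_commute)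
  qed
  have z2: "(y - x i) \<bullet> ?z = -1"
    using uv(2)[OF uv(1)] \<open>v \<noteq> 0\<close> unfolding uv(3)
    by (simp add: orthogonal_def inner_add_left inner_commute[of u v])
  show "\<exists>z. (\<forall>j\<in>J. (x j - x i) \<bullet> z = 0) \<and> (y - x i) \<bullet> z \<le> -1"
    using z1 eq_refl[OF z2] by blast
next
  assume "\<exists>z. (\<forall>j\<in>J. (x j - x i) \<bullet> z = 0) \<and> (y - x i) \<bullet> z \<le> -1"
  then obtain z where z: "\<And>j. j \<in> J \<Longrightarrow> (x j - x i) \<bullet> z = 0" "(y - x i) \<bullet> z \<le> -1"
    by blast
  have "affine hull (x ` J) \<subseteq> {p. z \<bullet> p = z \<bullet> x i}"
    using z(1) by (intro hull_minimal affine_hyperplane)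
      (auto simp: inner_diff_left inner_commute[of z])
  thus "y \<notin> affine hull (x ` J)"
    using z(2) by (auto simp: inner_diff_left inner_commute[of z])
qed

lemma sets_not_in_affine_hull:
  fixes x :: "'j \<Rightarrow> 'w \<Rightarrow> 'a::euclidean_space"
  assumes J: "finite J" and x[measurable]: "\<And>j. j \<in> J \<Longrightarrow> x j \<in> borel_measurable M"
    and y[measurable]: "y \<in> borel_measurable M"
  shows "{w\<in>space M. y w \<notin> affine hull ((\<lambda>j. x j w) ` J)} \<in> sets M"
proof (cases "J = {}")
  case False
  then obtain i where i: "i \<in> J"
    by blast
  \<comment> \<open>\<open>None\<close> labels the inequality for \<open>y\<close>, and
    \<open>Some j\<close> the equation for the point \<open>x j\<close>.\<close>
  let ?v = "case_option (\<lambda>w. y w - x i w) (\<lambda>j w. x j w - x i w)"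
  have "{w\<in>space M. \<exists>z. (\<forall>j\<in>Some ` J. ?v j w \<bullet> z = 0) \<and> (\<forall>j\<in>{None}. ?v j w \<bullet> z \<le> -1)} \<in> sets M"
    using J i by (intro sets_linear_feasibility) auto
  thus ?thesis
    by (simp add: not_in_affine_hull_iff[OF i])
qed simp

text \<open>Adding a point raises the dimension by one or not at all, according to the measurable
  event that it lies outside the hull of its predecessors.\<close>

lemma measurable_aff_dim:
  fixes x :: "'j \<Rightarrow> 'w \<Rightarrow> 'a::euclidean_space"
  assumes "finite J" and "\<And>j. j \<in> J \<Longrightarrow> x j \<in> borel_measurable M"
  shows "(\<lambda>w. aff_dim ((\<lambda>j. x j w) ` J)) \<in> measurable M (count_space UNIV)"
  using assms
proof (induction J rule: finite_induct)
  case (insert j J)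
  have [measurable]: "(\<lambda>w. aff_dim ((\<lambda>j. x j w) ` J)) \<in> measurable M (count_space UNIV)"
    using insert by auto
  have "{w\<in>space M. x j w \<notin> affine hull ((\<lambda>j. x j w) ` J)} \<in> sets M"
    using insert by (intro sets_not_in_affine_hull) auto
  hence [measurable]: "Measurable.pred M (\<lambda>w. x j w \<notin> affine hull ((\<lambda>j. x j w) ` J))"
    by (simp add: pred_def)
  have "(\<lambda>w. aff_dim ((\<lambda>j. x j w) ` insert j J)) =
      (\<lambda>w. if x j w \<notin> affine hull ((\<lambda>j. x j w) ` J) then aff_dim ((\<lambda>j. x j w) ` J) + 1
        else aff_dim ((\<lambda>j. x j w) ` J))"
    by (auto simp: aff_dim_insert)
  thus ?case
    by simp
qed simp

text \<open>
  For \<open>b > 0\<close> the set is the frontier of the convex cone \<open>b * norm w \<le> a \<bullet> w\<close>: moving from \<open>w\<close>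
  orthogonally to \<open>w\<close> increases the norm.
\<close>

lemma negligible_round_cone:
  fixes a :: "'a::euclidean_space"
  assumes dim: "DIM('a) \<ge> 2" and a: "a \<noteq> 0"
  shows "negligible {w. a \<bullet> w = b * norm w}"
proof -
  have pos: "negligible {w. a \<bullet> w = b * norm w}" if b: "b > 0" for a :: 'a and b
  proof -
    let ?C = "{w. b * norm w \<le> a \<bullet> w}"
    have convex: "convex ?C"
    proof (rule convexI, clarify)
      fix v w :: 'a and s t :: real
      assume *: "b * norm v \<le> a \<bullet> v" "b * norm w \<le> a \<bullet> w" "0 \<le> s" "0 \<le> t"
      have "b * norm (s *\<^sub>R v + t *\<^sub>R w) \<le> b * (s * norm v + t * norm w)"
        using b * norm_triangle_ineq[of "s *\<^sub>R v" "t *\<^sub>R w"] by (intro mult_left_mono) auto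
      also have "\<dots> = s * (b * norm v) + t * (b * norm w)"
        by (simp add: algebra_simps)
      also have "\<dots> \<le> s * (a \<bullet> v) + t * (a \<bullet> w)"
        using * by (intro add_mono mult_left_mono)
      finally show "b * norm (s *\<^sub>R v + t *\<^sub>R w) \<le> a \<bullet> (s *\<^sub>R v + t *\<^sub>R w)"
        by (simp add: inner_add_right)
    qed
    have "{w. a \<bullet> w = b * norm w} \<subseteq> frontier ?C"
    proof clarify
      fix w assume w: "a \<bullet> w = b * norm w"
      obtain v0 where v0: "v0 \<noteq> 0" "orthogonal w v0"
        using orthogonal_to_vector_exists[OF dim] .
      \<comment> \<open>The sign is chosen so that a step along \<open>v\<close> does not increase
        the product with \<open>a\<close>, while it does increase the norm.\<close>
      define v where "v = (if a \<bullet> v0 \<le> 0 then v0 else - v0)"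
      have v: "v \<noteq> 0" "orthogonal w v" "a \<bullet> v \<le> 0"
        using v0 by (auto simp: v_def orthogonal_def)
      have "w \<notin> interior ?C"
      proof
        assume "w \<in> interior ?C"
        then obtain e where e: "e > 0" "cball w e \<subseteq> ?C"
          by (meson mem_interior_cball)
        let ?u = "w + (e / norm v) *\<^sub>R v"
        have "?u \<in> cball w e"
          using e(1) v(1) by (simp add: dist_norm)
        hence "b * norm ?u \<le> a \<bullet> ?u"
          using e(2) by auto
        also have "\<dots> \<le> a \<bullet> w"
          using v(3) e(1) by (simp add: inner_add_right divide_nonpos_nonneg mult_nonneg_nonpos)
        finally have "norm ?u \<le> norm w"
          using b w by simp
        moreover have "norm w ^ 2 < norm ?u ^ 2"
        proof -
          have "norm ?u ^ 2 = norm w ^ 2 + norm ((e / norm v) *\<^sub>R v) ^ 2"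
            using v(2) by (intro norm_add_Pythagorean) (simp add: orthogonal_clauses)
          thus ?thesis
            using e(1) v(1) by simp
        qed
        hence "norm w < norm ?u"
          by (rule power_less_imp_less_base) simp
        ultimately show False
          by simp
      qed
      moreover have "w \<in> closure ?C"
        using w closure_subset by fastforce
      ultimately show "w \<in> frontier ?C"
        by (simp add: frontier_def)
    qed
    thus ?thesis
      using negligible_convex_frontier[OF convex] negligible_subset by blast
  qed
  consider "b = 0" | "b > 0" | "b < 0"
    by linarith
  thus ?thesis
  proof cases
    case 1
    thus ?thesis
      using negligible_hyperplane[of a 0] a by simp
  next
    case 3
    have "{w. a \<bullet> w = b * norm w} = {w. (- a) \<bullet> w = (- b) * norm w}"
      by auto
    thus ?thesis
      using pos[of "- b" "- a"] 3 by simp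
  qed (use pos in simp)
qed

section \<open>The spherical measure and its null sets\<close>

lemma sets_sphere_measure:
  "sets (sphere_measure :: 'a::euclidean_space measure) = sets (restrict_space borel (sphere 0 1))"
  by (simp add: sphere_measure_def sets_restrict_space)

lemma space_sphere_measure [simp]:
  "space (sphere_measure :: 'a::euclidean_space measure) = sphere 0 1"
  by (simp add: sphere_measure_def space_restrict_space)

lemma measurable_sphere_measure_borel:
  "(\<lambda>y. y) \<in> borel_measurable (sphere_measure :: 'a::euclidean_space measure)"
  unfolding measurable_cong_sets[OF sets_sphere_measure refl]
  by (intro measurable_restrict_space1 measurable_ident_sets refl)

text \<open>The cone measure is the image of Lebesgue measure on the ball under radial projection,
  so properties are checked along rays. The origin is exempt because \<open>sgn 0 = 0\<close> is not
  on the sphere.\<close>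

lemma AE_sphere_measureI:
  fixes P :: "'a::euclidean_space \<Rightarrow> bool"
  assumes P: "{y. P y} \<in> sets borel" and AE: "AE w in lborel. w \<noteq> 0 \<longrightarrow> P (sgn w)"
  shows "AE y in sphere_measure. P y"
proof -
  have sgn: "sgn \<in> measurable (uniform_measure lborel (ball 0 1)) (borel :: 'a measure)"
    by simp
  have [measurable]: "Measurable.pred borel P"
    using P by (simp add: pred_def)
  have "AE w in uniform_measure lborel (ball 0 1). sgn w \<in> sphere 0 1 \<longrightarrow> P (sgn w)"
    using AE by (intro AE_uniform_measureI) (auto simp: norm_sgn split: if_splits)
  hence "AE y in distr (uniform_measure lborel (ball 0 1)) borel sgn. y \<in> sphere 0 1 \<longrightarrow> P y"
    by (subst AE_distr_iff[OF sgn]) auto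
  thus ?thesis
    unfolding sphere_measure_def by (subst AE_restrict_space_iff) auto
qed

text \<open>Radial projection sends only the origin off the sphere, so the restriction loses no
  mass.\<close>

lemma prob_space_sphere_measure: "prob_space (sphere_measure :: 'a::euclidean_space measure)"
proof -
  let ?U = "uniform_measure lborel (ball 0 1) :: 'a measure"
  have sgn: "sgn \<in> measurable ?U (borel :: 'a measure)"
    by simp
  have "emeasure lborel (ball (0::'a) 1) \<noteq> 0"
    by (simp add: emeasure_ball unit_ball_vol_pos less_imp_neq[symmetric])
  moreover have "emeasure lborel (ball (0::'a) 1) \<noteq> \<infinity>"
    by (simp add: emeasure_ball)
  ultimately have "prob_space ?U"
    by (rule prob_space_uniform_measure)
  then interpret prob_space "distr ?U borel sgn"
    using sgn by (rule prob_space.prob_space_distr)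
  have "AE w in ?U. sgn w \<in> sphere 0 1"
    using AE_lborel_singleton[of 0] by (intro AE_uniform_measureI) (auto simp: norm_sgn)
  hence "AE y in distr ?U borel sgn. y \<in> sphere 0 1"
    by (subst AE_distr_iff[OF sgn]) auto
  hence "emeasure (distr ?U borel sgn) (sphere 0 1) = 1"
    by (intro emeasure_eq_1_AE) auto
  thus ?thesis
    unfolding sphere_measure_def by (intro prob_space_restrict_space) auto
qed

text \<open>The hull lies in a hyperplane \<open>a \<bullet> y = b\<close>, whose radial extension
  is the null set \<open>a \<bullet> w = b * norm w\<close>. On the line the sphere consists of two
  atoms, hence the bound on the dimension.\<close>

lemma AE_sphere_measure_not_in_affine_hull:
  fixes A :: "'a::euclidean_space set"
  assumes dim: "DIM('a) \<ge> 2" and A: "aff_dim A < DIM('a)"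
  shows "AE y in sphere_measure. y \<notin> affine hull A"
proof -
  obtain a b where ab: "a \<noteq> 0" "affine hull A \<subseteq> {y. a \<bullet> y = b}"
    using A aff_lowdim_subset_hyperplane[of "affine hull A"] by auto
  let ?H = "{w. a \<bullet> w = b * norm w}"
  have "closed ?H"
    by (intro closed_Collect_eq continuous_intros)
  hence "?H \<in> null_sets lborel"
    using negligible_round_cone[OF dim ab(1), of b]
    by (simp add: negligible_iff_null_sets null_sets_completion_iff)
  hence "AE w in lborel. a \<bullet> w \<noteq> b * norm w"
    by (rule AE_I') auto
  hence "AE w in lborel. w \<noteq> 0 \<longrightarrow> a \<bullet> sgn w \<noteq> b"
    by eventually_elim (auto simp: sgn_div_norm field_simps)
  hence "AE y in sphere_measure. a \<bullet> y \<noteq> b"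
    by (intro AE_sphere_measureI) measurable
  thus ?thesis
    by eventually_elim (use ab(2) in auto)
qed

section \<open>Almost sure general position\<close>

lemma affinely_independent_if_not_in_affine_hull:
  fixes x :: "'i \<Rightarrow> 'a::euclidean_space"
  assumes J: "finite J" "J \<subseteq> I" "card J \<le> m"
    and x: "\<And>J j. J \<subseteq> I \<Longrightarrow> card J < m \<Longrightarrow> j \<in> I - J \<Longrightarrow> x j \<notin> affine hull (x ` J)"
  shows "aff_dim (x ` J) = int (card J) - 1"
  using J
proof (induction J rule: finite_induct)
  case (insert j J)
  moreover from this have "x j \<notin> affine hull (x ` J)"
    by (intro x) auto
  ultimately show ?case
    by (simp add: aff_dim_insert)
qed simp

text \<open>Up to \<open>Suc m\<close> points are affinely independent. A larger index set contains
  \<open>Suc m\<close> of them and so has dimension at least \<open>m\<close>, which exceeds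
  \<open>r\<close>.\<close>

lemma aff_dim_image_eq_iff:
  fixes x :: "'i \<Rightarrow> 'a::euclidean_space"
  assumes x: "\<And>J. J \<subseteq> I \<Longrightarrow> card J \<le> Suc m \<Longrightarrow> aff_dim (x ` J) = int (card J) - 1"
    and J: "J \<subseteq> I" "finite J" and r: "r < m"
  shows "aff_dim (x ` J) = int r \<longleftrightarrow> card J = Suc r"
proof (cases "card J \<le> Suc m")
  case True
  hence "aff_dim (x ` J) = int (card J) - 1"
    using J(1) by (intro x)
  thus ?thesis
    by auto
next
  case False
  hence "Suc m \<le> card J"
    by simp
  then obtain K where K: "K \<subseteq> J" "card K = Suc m"
    by (rule obtain_subset_with_card_n)
  hence "aff_dim (x ` K) = int m"
    using x[of K] J(1) by (simp add: subset_trans[OF K(1)])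
  moreover have "aff_dim (x ` K) \<le> aff_dim (x ` J)"
    using K(1) by (intro aff_dim_subset image_mono)
  ultimately show ?thesis
    using r False by linarith
qed

lemma measurable_component_sphere_measure:
  assumes "i \<in> I"
  shows "(\<lambda>x. x i) \<in> borel_measurable (\<Pi>\<^sub>M i\<in>I. (sphere_measure :: 'a::euclidean_space measure))"
  using measurable_compose[OF measurable_component_singleton[OF assms] measurable_sphere_measure_borel]
  by simp

text \<open>By Fubini, the coordinate \<open>j\<close> is integrated first with all others fixed. At
  most \<open>DIM('a)\<close> fixed points span less than the whole space, so their affine hull is
  missed almost surely.\<close>

lemma AE_PiM_sphere_measure_not_in_affine_hull:
  fixes I J :: "'i set"
  assumes dim: "DIM('a::euclidean_space) \<ge> 2" and I: "finite I" and J: "J \<subseteq> I" "j \<in> I - J"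
    and card: "card J \<le> DIM('a)"
  shows "AE x in \<Pi>\<^sub>M i\<in>I. (sphere_measure :: 'a measure). x j \<notin> affine hull (x ` J)"
proof -
  let ?\<sigma> = "sphere_measure :: 'a measure"
  let ?\<Pi> = "\<lambda>I. \<Pi>\<^sub>M i\<in>I. ?\<sigma>"
  interpret prob_space ?\<sigma>
    by (rule prob_space_sphere_measure)
  interpret product_sigma_finite "\<lambda>_::'i. ?\<sigma>" ..
  let ?I' = "I - {j}"
  have fin: "finite ?I'" "j \<notin> ?I'" and ins: "insert j ?I' = I"
    using I J by auto
  define B where "B = {x\<in>space (?\<Pi> I). \<not> x j \<notin> affine hull (x ` J)}"
  have "{x\<in>space (?\<Pi> I). x j \<notin> affine hull ((\<lambda>i. x i) ` J)} \<in> sets (?\<Pi> I)"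
    using I J by (intro sets_not_in_affine_hull measurable_component_sphere_measure)
      (auto intro: finite_subset)
  hence "space (?\<Pi> I) - {x\<in>space (?\<Pi> I). x j \<notin> affine hull (x ` J)} \<in> sets (?\<Pi> I)"
    by auto
  also have "space (?\<Pi> I) - {x\<in>space (?\<Pi> I). x j \<notin> affine hull (x ` J)} = B"
    unfolding B_def by blast
  finally have B: "B \<in> sets (?\<Pi> I)" .
  have "emeasure (?\<Pi> I) B = (\<integral>\<^sup>+x. indicator B x \<partial>?\<Pi> I)"
    using B by simp
  also have "\<dots> = (\<integral>\<^sup>+x. (\<integral>\<^sup>+y. indicator B (x(j := y)) \<partial>?\<sigma>) \<partial>?\<Pi> ?I')"
    using product_nn_integral_insert[OF fin, of "indicator B"] B unfolding ins by simp
  also have "\<dots> = (\<integral>\<^sup>+x. 0 \<partial>?\<Pi> ?I')"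
  proof (rule nn_integral_cong)
    fix x :: "'i \<Rightarrow> 'a"
    have "aff_dim (x ` J) \<le> int (card (x ` J)) - 1"
      using I J by (intro aff_dim_le_card) (auto intro: finite_subset)
    also have "card (x ` J) \<le> card J"
      using I J by (intro card_image_le) (auto intro: finite_subset)
    finally have "aff_dim (x ` J) < DIM('a)"
      using card by simp
    hence "AE y in ?\<sigma>. y \<notin> affine hull (x ` J)"
      by (rule AE_sphere_measure_not_in_affine_hull[OF dim])
    moreover have "(x(j := y)) ` J = x ` J" for y
      using J by auto
    ultimately have "AE y in ?\<sigma>. indicator B (x(j := y)) = (0::ennreal)"
      by (auto simp: B_def indicator_def elim!: eventually_mono)
    hence "(\<integral>\<^sup>+y. indicator B (x(j := y)) \<partial>?\<sigma>) = (\<integral>\<^sup>+y. 0 \<partial>?\<sigma>)"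
      by (rule nn_integral_cong_AE)
    thus "(\<integral>\<^sup>+y. indicator B (x(j := y)) \<partial>?\<sigma>) = 0"
      by simp
  qed
  finally have "B \<in> null_sets (?\<Pi> I)"
    using B by auto
  thus ?thesis
    by (rule AE_I') (auto simp: B_def)
qed

text \<open>Only finitely many pairs of an index set and a further index occur, so their null events
  can be discarded together. This makes any \<open>DIM('a) + 1\<close> points affinely independent
  and settles all dimensions below \<open>DIM('a)\<close>.\<close>

lemma AE_PiM_sphere_measure_aff_dim:
  fixes I :: "'i set"
  assumes dim: "DIM('a::euclidean_space) \<ge> 2" and I: "finite I"
  shows "AE x in \<Pi>\<^sub>M i\<in>I. (sphere_measure :: 'a measure).
    \<forall>J\<subseteq>I. \<forall>r<DIM('a). aff_dim (x ` J) = int r \<longleftrightarrow> card J = Suc r"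
proof -
  let ?P = "{(J, j). J \<subseteq> I \<and> card J \<le> DIM('a) \<and> j \<in> I - J}"
  have "finite ?P"
    by (rule finite_subset[of _ "Pow I \<times> I"]) (use I in auto)
  hence "AE x in \<Pi>\<^sub>M i\<in>I. (sphere_measure :: 'a measure). \<forall>p\<in>?P. x (snd p) \<notin> affine hull (x ` fst p)"
    by (rule AE_finite_allI) (auto intro!: AE_PiM_sphere_measure_not_in_affine_hull[OF dim I])
  thus ?thesis
  proof eventually_elim
    fix x :: "'i \<Rightarrow> 'a"
    assume x: "\<forall>p\<in>?P. x (snd p) \<notin> affine hull (x ` fst p)"
    have "aff_dim (x ` J) = int (card J) - 1" if "J \<subseteq> I" "card J \<le> Suc DIM('a)" for J
      using that I x
      by (intro affinely_independent_if_not_in_affine_hull[of J I "Suc DIM('a)"])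
        (auto intro: finite_subset)
    thus "\<forall>J\<subseteq>I. \<forall>r<DIM('a). aff_dim (x ` J) = int r \<longleftrightarrow> card J = Suc r"
      using I by (intro allI impI aff_dim_image_eq_iff[of I]) (auto intro: finite_subset)
  qed
qed

section \<open>Measurability of the face events\<close>

text \<open>Finitely many strict inequalities can be rescaled to have slack at least 1. The
  resulting closed conditions survive the limit in the compactness argument behind
  \<open>sets_linear_feasibility\<close>.\<close>

lemma in_range_maximizers_iff:
  fixes x :: "'i \<Rightarrow> 'a::euclidean_space"
  assumes "finite I" and i: "i \<in> J" "J \<subseteq> I"
  shows "J \<in> range (maximizers x I) \<longleftrightarrow>
    (\<exists>z. (\<forall>j\<in>J. (x j - x i) \<bullet> z = 0) \<and> (\<forall>j\<in>I - J. (x j - x i) \<bullet> z \<le> -1))"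
proof
  assume "J \<in> range (maximizers x I)"
  then obtain z where z: "J = maximizers x I z"
    by auto
  have iI: "i \<in> I" "\<And>j. j \<in> I \<Longrightarrow> x j \<bullet> z \<le> x i \<bullet> z"
    using i unfolding z by (auto simp: maximizers_def)
  have eq: "(x j - x i) \<bullet> z = 0" if "j \<in> J" for j
    using that iI unfolding z by (auto simp: maximizers_def inner_diff_left intro: antisym)
  have lt: "(x i - x j) \<bullet> z > 0" if "j \<in> I - J" for j
  proof -
    from that obtain l where "l \<in> I" "x j \<bullet> z < x l \<bullet> z"
      unfolding z by (auto simp: maximizers_def not_le)
    with iI(2)[of l] show ?thesis
      by (simp add: inner_diff_left)
  qed
  \<comment> \<open>This factor enlarges every gap to at least 1; the inserted 1 keeps the maximum
    defined when \<open>J = I\<close>.\<close>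
  define c where "c = Max (insert 1 ((\<lambda>j. 1 / ((x i - x j) \<bullet> z)) ` (I - J)))"
  have le: "(x j - x i) \<bullet> (c *\<^sub>R z) \<le> -1" if "j \<in> I - J" for j
  proof -
    have "1 / ((x i - x j) \<bullet> z) \<le> c"
      using assms(1) that unfolding c_def by (intro Max_ge) auto
    hence "1 \<le> c * ((x i - x j) \<bullet> z)"
      using lt[OF that] by (simp add: pos_divide_le_eq)
    thus ?thesis
      by (simp add: inner_diff_left algebra_simps)
  qed
  have "(x j - x i) \<bullet> (c *\<^sub>R z) = 0" if "j \<in> J" for j
    using eq[OF that] by simp
  with le show "\<exists>z. (\<forall>j\<in>J. (x j - x i) \<bullet> z = 0) \<and> (\<forall>j\<in>I - J. (x j - x i) \<bullet> z \<le> -1)"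
    by blast
next
  assume "\<exists>z. (\<forall>j\<in>J. (x j - x i) \<bullet> z = 0) \<and> (\<forall>j\<in>I - J. (x j - x i) \<bullet> z \<le> -1)"
  then obtain z where *: "\<And>j. j \<in> J \<Longrightarrow> (x j - x i) \<bullet> z = 0"
      "\<And>j. j \<in> I - J \<Longrightarrow> (x j - x i) \<bullet> z \<le> -1"
    by blast
  have z: "x j \<bullet> z = x i \<bullet> z" if "j \<in> J" for j
    using *(1)[OF that] by (simp add: inner_diff_left)
  have z': "x j \<bullet> z < x i \<bullet> z" if "j \<in> I - J" for j
    using *(2)[OF that] by (simp add: inner_diff_left)
  have le: "x j \<bullet> z \<le> x i \<bullet> z" if "j \<in> I" for j
    using z[of j] z'[of j] that by (cases "j \<in> J") auto
  have "J = maximizers x I z"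
  proof (intro equalityI subsetI)
    fix j assume "j \<in> J"
    thus "j \<in> maximizers x I z"
      using z[of j] le i(2) by (auto simp: maximizers_def)
  next
    fix j assume "j \<in> maximizers x I z"
    hence "j \<in> I" "x i \<bullet> z \<le> x j \<bullet> z"
      using i by (auto simp: maximizers_def)
    thus "j \<in> J"
      using z'[of j] by auto
  qed
  thus "J \<in> range (maximizers x I)"
    by blast
qed

lemma sets_face_event:
  fixes I J :: "'i set"
  assumes I: "finite I" "I \<noteq> {}" and J: "J \<subseteq> I"
  shows "{x\<in>space (\<Pi>\<^sub>M i\<in>I. (sphere_measure :: 'a::euclidean_space measure)).
      J \<in> range (maximizers x I) \<and> aff_dim (x ` J) = r} \<in> sets (\<Pi>\<^sub>M i\<in>I. sphere_measure)"
proof (cases "J = {}")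
  case True
  hence "J \<notin> range (maximizers x I)" for x :: "'i \<Rightarrow> 'a"
    using maximizers_nonempty[OF I] by auto
  thus ?thesis
    by simp
next
  case False
  then obtain i where i: "i \<in> J"
    by blast
  let ?\<Pi> = "\<Pi>\<^sub>M i\<in>I. (sphere_measure :: 'a measure)"
  have finJ: "finite J"
    using I J finite_subset by blast
  have comp: "(\<lambda>x. x j) \<in> borel_measurable ?\<Pi>" if "j \<in> I" for j
    using that by (rule measurable_component_sphere_measure)
  have "{x\<in>space ?\<Pi>. J \<in> range (maximizers x I)} \<in> sets ?\<Pi>"
    unfolding in_range_maximizers_iff[OF I(1) i J]
    using I J i finJ by (intro sets_linear_feasibility borel_measurable_diff comp) auto
  moreover have "(\<lambda>x. aff_dim ((\<lambda>j. x j) ` J)) \<in> measurable ?\<Pi> (count_space UNIV)"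
    using finJ J by (intro measurable_aff_dim comp) auto
  hence "(\<lambda>x. aff_dim (x ` J)) -` {r} \<inter> space ?\<Pi> \<in> sets ?\<Pi>"
    by (rule measurable_sets) simp
  ultimately have "{x\<in>space ?\<Pi>. J \<in> range (maximizers x I)} \<inter>
      ((\<lambda>x. aff_dim (x ` J)) -` {r} \<inter> space ?\<Pi>) \<in> sets ?\<Pi>"
    by (rule sets.Int)
  also have "{x\<in>space ?\<Pi>. J \<in> range (maximizers x I)} \<inter>
      ((\<lambda>x. aff_dim (x ` J)) -` {r} \<inter> space ?\<Pi>) =
      {x\<in>space ?\<Pi>. J \<in> range (maximizers x I) \<and> aff_dim (x ` J) = r}"
    by blast
  finally show ?thesis .
qed

section \<open>Face numbers as counts of index sets, and the expectation identity\<close>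

lemma polytope_f_eq_card:
  fixes x :: "'i \<Rightarrow> 'a::euclidean_space"
  assumes "finite I" "I \<noteq> {}"
  shows "polytope_f m (convex hull (x ` I)) =
    card {J \<in> range (maximizers x I). aff_dim (x ` J) = int m}"
  unfolding polytope_f_def
  using bij_betw_same_card[OF bij_betw_faces_convex_hull[OF assms, of x m]] by (rule sym)

lemma spherical_f_typical_cell_eq_card:
  fixes x :: "nat \<Rightarrow> 'a::euclidean_space"
  assumes x: "\<And>j. j \<in> {1..n} \<Longrightarrow> x j \<in> sphere 0 1" and i: "i \<in> {1..n}"
    and f: "orthogonal_transformation (rot (x i))"
  shows "spherical_f k (typical_cell rot x n i) =
    card {J \<in> range (maximizers x {1..n}). i \<in> J \<and> aff_dim (x ` J) = int DIM('a) - int k - 1}"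
  unfolding spherical_f_def
  using bij_betw_same_card[OF bij_betw_faces_typical_cell[of n x i rot k]] x i f by simp

lemma real_card_eq_sum_if:
  assumes "finite A"
  shows "real (card {a\<in>A. P a}) = (\<Sum>a\<in>A. if P a then 1 else 0)"
  using assms by (simp add: sum.inter_filter[symmetric])

theorem theorem2p4:
  fixes d n k :: nat
    and M :: "'w measure"
    and X :: "nat \<Rightarrow> 'w \<Rightarrow> real ^ 'm"
    and N :: "'w \<Rightarrow> nat"
    and rot :: "real ^ 'm \<Rightarrow> real ^ 'm \<Rightarrow> real ^ 'm"
    and i0 :: "'m"
  assumes d: "d \<ge> 1" and dim: "CARD('m) = d + 1" and n: "n \<ge> d + 1" and k: "k \<le> d"
    and M: "prob_space M"
    and X_indep: "prob_space.indep_vars M (\<lambda>_. sphere_measure) X {1..n}"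
    and X_distr: "\<And>i. i \<in> {1..n} \<Longrightarrow> distr M sphere_measure (X i) = sphere_measure"
    and N_meas: "N \<in> M \<rightarrow>\<^sub>M count_space {1..n}"
    and N_indep: "prob_space.indep_set M
           (sets (vimage_algebra (space M) N (count_space {1..n})))
           (sets (vimage_algebra (space M) (\<lambda>\<omega>. \<lambda>i\<in>{1..n}. X i \<omega>)
              (\<Pi>\<^sub>M i\<in>{1..n}. sphere_measure)))"
    and N_distr: "distr M (count_space {1..n}) N = uniform_count_measure {1..n}"
    and rot_orth: "\<And>v. v \<in> sphere 0 1 \<Longrightarrow> orthogonal_transformation (rot v)"
    and rot_pole: "\<And>v. v \<in> sphere 0 1 \<Longrightarrow> rot v v = axis i0 1"
    and rot_meas: "\<And>i j. (\<lambda>v. matrix (rot v) $ i $ j)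
           \<in> borel_measurable (restrict_space borel (sphere 0 1))"
  shows "integrable M
           (\<lambda>\<omega>. real (spherical_f k (typical_cell rot (\<lambda>i. X i \<omega>) n (N \<omega>)))) \<and>
         integrable M
           (\<lambda>\<omega>. real (polytope_f (d - k) (convex hull ((\<lambda>i. X i \<omega>) ` {1..n})))) \<and>
         prob_space.expectation M
           (\<lambda>\<omega>. real (spherical_f k (typical_cell rot (\<lambda>i. X i \<omega>) n (N \<omega>)))) =
         real (d - k + 1) / real n *
         prob_space.expectation M
           (\<lambda>\<omega>. real (polytope_f (d - k) (convex hull ((\<lambda>i. X i \<omega>) ` {1..n}))))"
proof -
  let ?I = "{1..n}" and ?\<Pi> = "\<Pi>\<^sub>M i\<in>{1..n}. (sphere_measure :: (real ^ 'm) measure)"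
  interpret prob_space M
    by (rule M)
  have fin: "finite ?I" and ne: "?I \<noteq> {}"
    using n by auto
  have DIM: "DIM(real ^ 'm) = d + 1" "DIM(real ^ 'm) \<ge> 2"
    using dim d by simp_all
  have X_rv: "X i \<in> measurable M sphere_measure" if "i \<in> ?I" for i
    using X_indep that unfolding indep_vars_def by blast
  \<comment> \<open>Restricting to the index range places the configuration in the product space,
    where its law is the product of sphere measures.\<close>
  define Y where "Y = (\<lambda>\<omega>. \<lambda>i\<in>?I. X i \<omega>)"
  have Y: "Y \<in> measurable M ?\<Pi>"
    unfolding Y_def using X_rv by (rule measurable_restrict)
  have "distr M ?\<Pi> Y = (\<Pi>\<^sub>M i\<in>?I. distr M sphere_measure (X i))"
    using indep_vars_iff_distr_eq_PiM'[OF ne, of X "\<lambda>_. sphere_measure"] X_rv X_indep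
    unfolding Y_def by blast
  also have "\<dots> = ?\<Pi>"
    using X_distr by (intro PiM_cong) auto
  finally have Y_distr: "distr M ?\<Pi> Y = ?\<Pi>" .
  \<comment> \<open>The same events serve both sides: \<open>A J\<close> says that \<open>J\<close>
    indexes a \<open>(d - k)\<close>-dimensional face of the convex hull, and \<open>B i\<close>
    that the index \<open>i\<close> is drawn.\<close>
  define Ev where "Ev = (\<lambda>J. {x\<in>space ?\<Pi>. J \<in> range (maximizers x ?I) \<and> aff_dim (x ` J) = int (d - k)})"
  have Ev: "Ev J \<in> sets ?\<Pi>" if "J \<subseteq> ?I" for J
    unfolding Ev_def using that by (intro sets_face_event fin ne)
  define A where "A = (\<lambda>J. Y -` Ev J \<inter> space M)"
  define B where "B = (\<lambda>i. N -` {i} \<inter> space M)"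
  have A: "A J \<in> events" if "J \<subseteq> ?I" for J
    unfolding A_def using Y Ev[OF that] by (rule measurable_sets)
  have B: "B i \<in> events" if "i \<in> ?I" for i
    unfolding B_def using that by (intro measurable_sets[OF N_meas]) simp
  have A_iff: "\<omega> \<in> A J \<longleftrightarrow> J \<in> range (maximizers (\<lambda>i. X i \<omega>) ?I) \<and>
      aff_dim ((\<lambda>i. X i \<omega>) ` J) = int (d - k)" if "\<omega> \<in> space M" "J \<subseteq> ?I" for \<omega> J
  proof -
    have "maximizers (Y \<omega>) ?I z = maximizers (\<lambda>i. X i \<omega>) ?I z" for z
      unfolding maximizers_def Y_def by auto
    hence "range (maximizers (Y \<omega>) ?I) = range (maximizers (\<lambda>i. X i \<omega>) ?I)"
      by simp
    moreover have "Y \<omega> ` J = (\<lambda>i. X i \<omega>) ` J"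
      using that(2) unfolding Y_def by (intro image_cong) auto
    moreover have "Y \<omega> \<in> space ?\<Pi>"
      using Y that(1) by (rule measurable_space)
    ultimately show ?thesis
      using that(1) unfolding A_def Ev_def by simp
  qed
  \<comment> \<open>General position applies because \<open>d - k\<close> is below the dimension
    \<open>d + 1\<close> of the space: almost surely only index sets of size
    \<open>d - k + 1\<close> contribute.\<close>
  have A_null: "prob (A J) = 0" if "J \<subseteq> ?I" "card J \<noteq> d - k + 1" for J
  proof -
    have "AE x in ?\<Pi>. \<forall>J\<subseteq>?I. \<forall>r<DIM(real ^ 'm). aff_dim (x ` J) = int r \<longleftrightarrow> card J = Suc r"
      by (rule AE_PiM_sphere_measure_aff_dim[OF DIM(2) fin])
    hence "AE x in distr M ?\<Pi> Y. x \<notin> Ev J"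
      unfolding Y_distr
    proof eventually_elim
      case (elim x)
      have "d - k < DIM(real ^ 'm)"
        using DIM(1) by simp
      with elim that have "aff_dim (x ` J) \<noteq> int (d - k)"
        by simp
      thus "x \<notin> Ev J"
        unfolding Ev_def by blast
    qed
    hence "AE \<omega> in M. Y \<omega> \<notin> Ev J"
      by (rule AE_distrD[OF Y])
    hence "AE \<omega> in M. \<omega> \<notin> A J"
      by eventually_elim (simp add: A_def)
    thus ?thesis
      using prob_eq_0[OF A[OF that(1)]] by simp
  qed
  have prob_B: "prob (B i) = 1 / real n" if "i \<in> ?I" for i
  proof -
    have "prob (B i) = measure (distr M (count_space ?I) N) {i}"
      unfolding B_def using that by (intro measure_distr[symmetric] N_meas) simp
    also have "\<dots> = 1 / real n"
      unfolding N_distr using that by (simp add: measure_uniform_count_measure)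
    finally show ?thesis .
  qed
  \<comment> \<open>The drawn index is independent of the whole configuration, and
    \<open>A J\<close> is an event of the configuration alone.\<close>
  have prob_BA: "prob (B i \<inter> A J) = prob (A J) / real n" if "i \<in> ?I" "J \<subseteq> ?I" for i J
  proof -
    have "prob (B i \<inter> A J) = prob (B i) * prob (A J)"
      using N_indep
    proof (rule indep_setD)
      show "B i \<in> sets (vimage_algebra (space M) N (count_space ?I))"
        unfolding B_def using that(1) by (intro in_vimage_algebra) simp
      show "A J \<in> sets (vimage_algebra (space M) (\<lambda>\<omega>. \<lambda>i\<in>?I. X i \<omega>) ?\<Pi>)"
        unfolding A_def Y_def using Ev[OF that(2)] by (rule in_vimage_algebra)
    qed
    thus ?thesis
      using prob_B[OF that(1)] by simp
  qed
  let ?f = "\<lambda>\<omega>. real (spherical_f k (typical_cell rot (\<lambda>i. X i \<omega>) n (N \<omega>)))"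
  let ?g = "\<lambda>\<omega>. real (polytope_f (d - k) (convex hull ((\<lambda>i. X i \<omega>) ` ?I)))"
  have range_sub: "range (maximizers x ?I) \<subseteq> Pow ?I" for x :: "nat \<Rightarrow> real ^ 'm"
    by (auto simp: maximizers_def)
  have g: "?g \<omega> = (\<Sum>J\<in>Pow ?I. indicator (A J) \<omega>)" if \<omega>: "\<omega> \<in> space M" for \<omega>
  proof -
    have "{J \<in> range (maximizers (\<lambda>i. X i \<omega>) ?I). aff_dim ((\<lambda>i. X i \<omega>) ` J) = int (d - k)} =
        {J\<in>Pow ?I. \<omega> \<in> A J}"
      using A_iff[OF \<omega>] range_sub[of "\<lambda>i. X i \<omega>"] by blast
    hence "?g \<omega> = real (card {J\<in>Pow ?I. \<omega> \<in> A J})"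
      using polytope_f_eq_card[OF fin ne, where x = "\<lambda>i. X i \<omega>" and m = "d - k"] by (simp only:)
    also have "\<dots> = (\<Sum>J\<in>Pow ?I. if \<omega> \<in> A J then 1 else 0)"
      using fin by (intro real_card_eq_sum_if) simp
    also have "\<dots> = (\<Sum>J\<in>Pow ?I. indicator (A J) \<omega>)"
      by (intro sum.cong refl) (simp add: indicator_def)
    finally show ?thesis .
  qed
  have f: "?f \<omega> = (\<Sum>J\<in>Pow ?I. \<Sum>i\<in>J. indicator (B i \<inter> A J) \<omega>)" if \<omega>: "\<omega> \<in> space M" for \<omega>
  proof -
    have N: "N \<omega> \<in> ?I"
      using measurable_space[OF N_meas \<omega>] by simp
    have X: "X i \<omega> \<in> sphere 0 1" if "i \<in> ?I" for i
      using measurable_space[OF X_rv[OF that] \<omega>] by simp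
    \<comment> \<open>As \<open>k \<le> d\<close>, the natural subtraction is not truncated, so the
      faces of the cell and of the hull are counted at the same dimension.\<close>
    have dim_eq: "int DIM(real ^ 'm) - int k - 1 = int (d - k)"
      using k DIM(1) by simp
    have "?f \<omega> = real (card {J \<in> range (maximizers (\<lambda>i. X i \<omega>) ?I). N \<omega> \<in> J \<and>
        aff_dim ((\<lambda>i. X i \<omega>) ` J) = int (d - k)})"
      using spherical_f_typical_cell_eq_card[of n "\<lambda>i. X i \<omega>" "N \<omega>" rot k,
          OF X N rot_orth[OF X[OF N]]]
      unfolding dim_eq by (rule arg_cong)
    also have "{J \<in> range (maximizers (\<lambda>i. X i \<omega>) ?I). N \<omega> \<in> J \<and>
        aff_dim ((\<lambda>i. X i \<omega>) ` J) = int (d - k)} = {J\<in>Pow ?I. N \<omega> \<in> J \<and> \<omega> \<in> A J}"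
      using A_iff[OF \<omega>] range_sub[of "\<lambda>i. X i \<omega>"] by blast
    also have "real (card \<dots>) = (\<Sum>J\<in>Pow ?I. if N \<omega> \<in> J \<and> \<omega> \<in> A J then 1 else 0)"
      using fin by (intro real_card_eq_sum_if) simp
    also have "\<dots> = (\<Sum>J\<in>Pow ?I. \<Sum>i\<in>J. indicator (B i \<inter> A J) \<omega>)"
    proof (rule sum.cong)
      fix J assume "J \<in> Pow ?I"
      hence "finite J"
        using finite_subset by auto
      \<comment> \<open>Exactly one of the events \<open>B i\<close> occurs, so the sum over
        \<open>J\<close> has a single possible nonzero term, at
        \<open>i = N \<omega>\<close>.\<close>
      have "(\<Sum>i\<in>J. indicator (B i \<inter> A J) \<omega>) = (\<Sum>i\<in>J. if i = N \<omega> then indicator (A J) \<omega> else (0::real))"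
        using \<omega> by (intro sum.cong) (auto simp: B_def indicator_def)
      also have "\<dots> = (if N \<omega> \<in> J \<and> \<omega> \<in> A J then 1 else 0)"
        using \<open>finite J\<close> by (simp add: indicator_def)
      finally show "(if N \<omega> \<in> J \<and> \<omega> \<in> A J then 1 else 0) = (\<Sum>i\<in>J. indicator (B i \<inter> A J) \<omega> :: real)"
        by simp
    qed simp
    finally show ?thesis .
  qed
  have int_A: "integrable M (indicator (A J) :: 'w \<Rightarrow> real)" if "J \<in> Pow ?I" for J
    using A that by (intro integrable_real_indicator) (auto simp: less_top[symmetric])
  have int_BA: "integrable M (indicator (B i \<inter> A J) :: 'w \<Rightarrow> real)" if "J \<in> Pow ?I" "i \<in> J" for i J
    using A B that by (intro integrable_real_indicator sets.Int) (auto simp: less_top[symmetric])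
  have "integrable M ?g \<longleftrightarrow> integrable M (\<lambda>\<omega>. \<Sum>J\<in>Pow ?I. indicator (A J) \<omega> :: real)"
    by (rule Bochner_Integration.integrable_cong[OF refl g])
  hence "integrable M ?g"
    using int_A by (simp only: Bochner_Integration.integrable_sum)
  moreover have "integrable M ?f \<longleftrightarrow>
      integrable M (\<lambda>\<omega>. \<Sum>J\<in>Pow ?I. \<Sum>i\<in>J. indicator (B i \<inter> A J) \<omega> :: real)"
    by (rule Bochner_Integration.integrable_cong[OF refl f])
  hence "integrable M ?f"
    using int_BA by (simp only: Bochner_Integration.integrable_sum)
  moreover have "expectation ?f = real (d - k + 1) / real n * expectation ?g"
  proof -
    have "expectation ?f = expectation (\<lambda>\<omega>. \<Sum>J\<in>Pow ?I. \<Sum>i\<in>J. indicator (B i \<inter> A J) \<omega>)"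
      by (rule Bochner_Integration.integral_cong[OF refl f])
    also have "\<dots> = (\<Sum>J\<in>Pow ?I. expectation (\<lambda>\<omega>. \<Sum>i\<in>J. indicator (B i \<inter> A J) \<omega>))"
      using int_BA by (intro Bochner_Integration.integral_sum Bochner_Integration.integrable_sum)
    also have "\<dots> = (\<Sum>J\<in>Pow ?I. \<Sum>i\<in>J. expectation (indicator (B i \<inter> A J)))"
      using int_BA by (intro sum.cong refl Bochner_Integration.integral_sum)
    also have "\<dots> = (\<Sum>J\<in>Pow ?I. \<Sum>i\<in>J. prob (A J) / real n)"
    proof (intro sum.cong refl)
      fix J i assume "J \<in> Pow ?I" "i \<in> J"
      moreover from this have "B i \<inter> A J \<subseteq> space M"
        by (auto simp: B_def)
      ultimately show "expectation (indicator (B i \<inter> A J)) = prob (A J) / real n"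
        using prob_BA[of i J] by (auto simp: Int_absorb2 subset_iff)
    qed
    also have "\<dots> = (\<Sum>J\<in>Pow ?I. real (d - k + 1) / real n * prob (A J))"
    proof (rule sum.cong)
      fix J assume "J \<in> Pow ?I"
      \<comment> \<open>The sum equals \<open>card J\<close> times a constant; either
        \<open>card J\<close> is the desired factor, or the probability is zero and both sides
        vanish.\<close>
      thus "(\<Sum>i\<in>J. prob (A J) / real n) = real (d - k + 1) / real n * prob (A J)"
        using A_null[of J] by (cases "card J = d - k + 1") auto
    qed simp
    also have "\<dots> = real (d - k + 1) / real n * (\<Sum>J\<in>Pow ?I. expectation (indicator (A J)))"
      unfolding sum_distrib_left by (intro sum.cong refl) (auto simp: A_def Int_absorb2 Int_assoc)
    also have "(\<Sum>J\<in>Pow ?I. expectation (indicator (A J))) =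
        expectation (\<lambda>\<omega>. \<Sum>J\<in>Pow ?I. indicator (A J) \<omega> :: real)"
      using int_A by (intro Bochner_Integration.integral_sum[symmetric])
    also have "\<dots> = expectation ?g"
      by (rule Bochner_Integration.integral_cong[OF refl g, symmetric])
    finally show ?thesis .
  qed
  ultimately show ?thesis
    by blast
qed

end
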